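(* Let $L$ and $N$ be positive integers. Let $\mathcal{C}=\{f\in L^1_{\mathbb{R},\mathrm{s}}(\mathbb{Z}) : f\geq 0\}$ and $\mathcal{P}=\{f\in L^1_{\mathbb{R},\mathrm{s}}(\mathbb{Z}) : \hat f\geq 0\}$. Define $$C(L,N):=\inf\left\{C\in\mathbb{R} \;:\; \sum_{k=-LN}^{LN} f(k)\leq (C+1)\sum_{k=-N}^{N} f(k)\ \text{ for every } f\in\mathcal{C}\cap\mathcal{P}\right\}$$ and $$K(L,N):=\inf\left\{h(0) \;:\; h\in L^\infty_{\mathbb{R},\mathrm{s}}(\mathbb{Z}),\ h \text{ is positive definite, and } h(k)\leq -\chi_{\{-LN,\dots,LN\}}(k)\ \text{ for all } k\in\mathbb{Z} \text{ with } |k|>N\right\}.$$ Then $$C(L,N)=K(L,N).$$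
   Context: $L^1_{\mathbb{R},\mathrm{s}}(\mathbb{Z})$ is the real Banach space of all real-valued, symmetric ($f(-k)=f(k)$), absolutely summable functions on $\mathbb{Z}$. $L^\infty_{\mathbb{R},\mathrm{s}}(\mathbb{Z})$ is the space of all real-valued, symmetric, bounded functions on $\mathbb{Z}$. For $f\in L^1_{\mathbb{R},\mathrm{s}}(\mathbb{Z})$, the Fourier transform is $\hat f(x)=\sum_{k\in\mathbb{Z}} f(k)e^{-ikx}$ for $x\in\mathbb{T}=\mathbb{R}/2\pi\mathbb{Z}$; it is real-valued by symmetry, and $\hat f\geq 0$ means $\hat f(x)\geq 0$ for all $x\in\mathbb{T}$. The symbol $\chi_E$ denotes the indicator function of $E\subseteq\mathbb{Z}$. A function $h\in L^\infty_{\mathbb{R},\mathrm{s}}(\mathbb{Z})$ is positive definite if $\sum_{i,j=1}^m z_i\overline{z_j}\,h(n_i-n_j)\geq 0$ for all $m\geq 1$, $n_1,\dots,n_m\in\mathbb{Z}$ and $z_1,\dots,z_m\in\mathbb{C}$. *)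

theory Defs
  imports "HOL-Analysis.Analysis"
begin

definition L1_sym :: "(int \<Rightarrow> real) set" where
  "L1_sym = {f. (\<forall>k. f (- k) = f k) \<and> (\<lambda>k. \<bar>f k\<bar>) summable_on UNIV}"

definition Linf_sym :: "(int \<Rightarrow> real) set" where
  "Linf_sym = {h. (\<forall>k. h (- k) = h k) \<and> bounded (range h)}"

text \<open>A function on the torus is represented by its \<open>2\<pi>\<close>-periodic lift to the real line.\<close>

definition fourier :: "(int \<Rightarrow> real) \<Rightarrow> real \<Rightarrow> complex" where
  "fourier f x = (\<Sum>\<^sub>\<infinity>k\<in>UNIV. complex_of_real (f k) * exp (- \<i> * of_int k * of_real x))"

text \<open>
  For a complex number \<open>z\<close>, the inequality \<open>z \<ge> 0\<close> is written \<open>z \<in> \<real>\<^sub>\<ge>\<^sub>0\<close>: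
  \<open>z\<close> is real and nonnegative.
\<close>

definition cone_C :: "(int \<Rightarrow> real) set" where
  "cone_C = {f \<in> L1_sym. \<forall>k. 0 \<le> f k}"

definition cone_P :: "(int \<Rightarrow> real) set" where
  "cone_P = {f \<in> L1_sym. \<forall>x. fourier f x \<in> \<real>\<^sub>\<ge>\<^sub>0}"

definition positive_definite :: "(int \<Rightarrow> real) \<Rightarrow> bool" where
  "positive_definite h \<longleftrightarrow>
     (\<forall>m\<ge>1. \<forall>(n :: nat \<Rightarrow> int) (z :: nat \<Rightarrow> complex).
        (\<Sum>i=1..m. \<Sum>j=1..m. z i * cnj (z j) * complex_of_real (h (n i - n j))) \<in> \<real>\<^sub>\<ge>\<^sub>0)"

definition C_const :: "nat \<Rightarrow> nat \<Rightarrow> real" where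
  "C_const L N = Inf {C. \<forall>f \<in> cone_C \<inter> cone_P.
     (\<Sum>k = - int (L * N)..int (L * N). f k) \<le> (C + 1) * (\<Sum>k = - int N..int N. f k)}"

definition K_const :: "nat \<Rightarrow> nat \<Rightarrow> real" where
  "K_const L N = Inf {h 0 | h. h \<in> Linf_sym \<and> positive_definite h \<and>
     (\<forall>k. \<bar>k\<bar> > int N \<longrightarrow> h k \<le> - indicator {- int (L * N)..int (L * N)} k)}"

text \<open>
  Both infima are over nonempty sets of reals that are bounded below, so \<^const>\<open>Inf\<close> on
  \<^typ>\<open>real\<close> is the usual infimum.  For \<^const>\<open>C_const\<close>: \<open>f = \<chi>\<^bsub>{0}\<^esub>\<close> forces \<open>C \<ge> 0\<close>, and
  \<open>C = 2LN\<close> is admissible because \<open>f(k) \<le> f(0)\<close> for \<open>f\<close> with nonnegative transform.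
  For \<^const>\<open>K_const\<close>: \<open>m = 1\<close> gives \<open>h(0) \<ge> 0\<close>, and \<open>2LN \<chi>\<^bsub>{0}\<^esub> - \<chi>\<^bsub>{N < |k| \<le> LN}\<^esub>\<close>
  is admissible, being positive definite because its Fourier transform is nonnegative.
\<close>

end

theory Submission
  imports Defs
begin

text \<open>
  The two constants are the values of a pair of dual linear programs, and the theorem says that
  there is no duality gap.

  Weak duality (\<open>dual_certificate_bound\<close>): if \<open>f\<close> has nonnegative transform and \<open>h\<close> is positive
  definite, then \<open>\<Sum> f h \<ge> 0\<close>.  For \<open>f \<ge> 0\<close> and \<open>h\<close> feasible for \<open>K_const\<close>, the left-hand side is
  at most \<open>h 0\<close> times the sum of \<open>f\<close> over \<open>\<bar>k\<bar> \<le> N\<close>, minus the sum of \<open>f\<close> over \<open>N < \<bar>k\<bar> \<le> L N\<close>.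
  Hence \<open>h 0\<close> is admissible for \<open>C_const\<close>.  The sign of \<open>\<Sum> f h\<close> is used in the form of sums over
  squares of \<open>f (i - j) h (i - j)\<close>, which are nonnegative because \<open>f\<close> is a limit of averages of
  cosines against its nonnegative transform (\<open>cone_P_pairing_nonneg\<close>).

  Strong duality (\<open>dual_certificate_exists\<close>): let \<open>C > 0\<close> be admissible for \<open>C_const\<close>.  A feasible
  \<open>h\<close> with \<open>h 0 \<le> C\<close> is wanted.  Instead of the Hahn-Banach theorem, the argument uses that the
  symmetric positive definite functions with \<open>h 0 \<le> C\<close> are compact for pointwise convergence
  (\<open>compact_pd_ball\<close>), so that among them there is one for which a weighted square sum of the
  constraint violations is minimal.  Were the minimum positive, its gradient, corrected by a point
  mass at \<open>0\<close>, would be a function in both cones contradicting admissibility of \<open>C\<close>; here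
  the functions \<open>k \<mapsto> cos (k x)\<close>, as test directions, detect nonnegativity of the transform.
\<close>

section \<open>Averages over the circle and Fourier inversion\<close>

lemma summable_on_mult_bounded:
  fixes f c :: "'a \<Rightarrow> real"
  assumes "(\<lambda>k. \<bar>f k\<bar>) summable_on A" and "\<And>k. k \<in> A \<Longrightarrow> \<bar>c k\<bar> \<le> B"
  shows "(\<lambda>k. f k * c k) summable_on A"
proof -
  have "(\<lambda>k. norm (f k * c k)) summable_on A"
  proof (rule summable_on_comparison_test)
    show "(\<lambda>k. \<bar>f k\<bar> * B) summable_on A"
      using assms(1) by (rule summable_on_cmult_left)
    show "norm (f k * c k) \<le> \<bar>f k\<bar> * B" if "k \<in> A" for k
      using assms(2)[OF that] by (simp add: abs_mult mult_left_mono)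
  qed auto
  then show ?thesis
    by (rule abs_summable_summable)
qed

lemma has_sum_finite_sum:
  fixes f :: "'a \<Rightarrow> 'b \<Rightarrow> 'c :: topological_comm_monoid_add"
  assumes "\<And>i. i \<in> I \<Longrightarrow> (f i has_sum s i) A"
  shows "((\<lambda>x. \<Sum>i\<in>I. f i x) has_sum (\<Sum>i\<in>I. s i)) A"
  using assms by (induction I rule: infinite_finite_induct) (auto intro: has_sum_add)

text \<open>
  Dominated convergence for series: the partial sums converge uniformly in \<open>n\<close> by the
  Weierstrass test, so the two limits may be exchanged.
\<close>

lemma infsum_tannery:
  fixes f :: "'a \<Rightarrow> real" and c :: "nat \<Rightarrow> 'a \<Rightarrow> real"
  assumes f: "(\<lambda>k. \<bar>f k\<bar>) summable_on A"
    and B: "\<And>n k. \<bar>c n k\<bar> \<le> B"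
    and lim: "\<And>k. (\<lambda>n. c n k) \<longlonglongrightarrow> d k"
  shows "(\<lambda>n. \<Sum>\<^sub>\<infinity>k\<in>A. f k * c n k) \<longlonglongrightarrow> (\<Sum>\<^sub>\<infinity>k\<in>A. f k * d k)"
proof -
  have d: "\<bar>d k\<bar> \<le> B" for k
    using tendsto_rabs[OF lim] by (rule LIMSEQ_le_const2) (use B in auto)
  have "uniform_limit UNIV (\<lambda>X n. \<Sum>k\<in>X. f k * c n k) (\<lambda>n. \<Sum>\<^sub>\<infinity>k\<in>A. f k * c n k)
          (finite_subsets_at_top A)"
    by (rule Weierstrass_m_test_general[where M = "\<lambda>k. \<bar>f k\<bar> * B"])
      (use B f in \<open>auto simp: abs_mult intro!: mult_left_mono summable_on_cmult_left\<close>)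
  moreover have "((\<lambda>X. \<Sum>k\<in>X. f k * d k) \<longlongrightarrow> (\<Sum>\<^sub>\<infinity>k\<in>A. f k * d k)) (finite_subsets_at_top A)"
    by (rule infsum_tendsto[OF summable_on_mult_bounded[OF f d]])
  moreover have "\<forall>\<^sub>F X in finite_subsets_at_top A.
      ((\<lambda>n. \<Sum>k\<in>X. f k * c n k) \<longlongrightarrow> (\<Sum>k\<in>X. f k * d k)) sequentially"
    by (intro always_eventually allI tendsto_intros lim)
  ultimately show ?thesis
    by (intro swap_uniform_limit'[where S = UNIV and F = "finite_subsets_at_top A"
          and f = "\<lambda>X n. \<Sum>k\<in>X. f k * c n k" and g = "\<lambda>X. \<Sum>k\<in>X. f k * d k"]) auto
qed

lemma L1_symD:
  assumes "f \<in> L1_sym"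
  shows "f (- k) = f k" and "(\<lambda>k. \<bar>f k\<bar>) summable_on UNIV"
  using assms by (auto simp: L1_sym_def)

lemma infsum_odd_eq_0:
  fixes g :: "int \<Rightarrow> real"
  assumes "\<And>k. g (- k) = - g k"
  shows "(\<Sum>\<^sub>\<infinity>k. g k) = 0"
proof -
  have "(\<Sum>\<^sub>\<infinity>k. g k) = (\<Sum>\<^sub>\<infinity>k. g (- k))"
    by (rule infsum_reindex_bij_betw[symmetric]) (rule bij_uminus)
  then show ?thesis
    by (simp add: assms infsum_uminus)
qed

text \<open>
  By symmetry the sine part is an odd series and vanishes, so membership in \<open>cone_P\<close> is a
  sign condition on a real cosine series.
\<close>

lemma fourier_eq_cosine_series:
  assumes f: "f \<in> L1_sym"
  shows "fourier f x = complex_of_real (\<Sum>\<^sub>\<infinity>k. f k * cos (of_int k * x))"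
proof -
  have term_eq: "complex_of_real (f k) * exp (- \<i> * of_int k * of_real x) =
      of_real (f k * cos (of_int k * x)) + (- \<i>) * of_real (f k * sin (of_int k * x))" for k
  proof -
    have "exp (- \<i> * of_int k * of_real x) = cis (- (of_int k * x))"
      by (simp add: cis_conv_exp mult.assoc)
    then show ?thesis
      by (simp add: complex_eq_iff)
  qed
  have c: "((\<lambda>k. f k * cos (of_int k * x)) has_sum (\<Sum>\<^sub>\<infinity>k. f k * cos (of_int k * x))) UNIV"
    by (intro has_sum_infsum summable_on_mult_bounded[where B = 1] L1_symD[OF f]) auto
  have "(\<lambda>k. f k * sin (of_int k * x)) summable_on UNIV"
    by (intro summable_on_mult_bounded[where B = 1] L1_symD[OF f]) auto
  moreover have "(\<Sum>\<^sub>\<infinity>k. f k * sin (of_int k * x)) = 0"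
    by (rule infsum_odd_eq_0) (simp add: L1_symD(1)[OF f])
  ultimately have s: "((\<lambda>k. f k * sin (of_int k * x)) has_sum 0) UNIV"
    using has_sum_infsum by metis
  have "((\<lambda>k. complex_of_real (f k) * exp (- \<i> * of_int k * of_real x)) has_sum
      (of_real (\<Sum>\<^sub>\<infinity>k. f k * cos (of_int k * x)) + (- \<i>) * of_real 0)) UNIV"
    unfolding term_eq
    by (intro has_sum_add has_sum_cmult_right has_sum_of_real c s)
  then show ?thesis
    unfolding fourier_def by (simp add: infsumI)
qed

lemma cone_P_iff_cosine_series:
  "f \<in> cone_P \<longleftrightarrow> f \<in> L1_sym \<and> (\<forall>x. 0 \<le> (\<Sum>\<^sub>\<infinity>k. f k * cos (of_int k * x)))"
  by (auto simp: cone_P_def fourier_eq_cosine_series complex_nonneg_Reals_iff)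

text \<open>
  Averages over the \<open>P\<close>-th roots of unity, with \<open>P \<rightarrow> \<infinity>\<close>, stand in for
  \<open>1/(2\<pi>) \<integral>\<close> over the circle: being finite sums, they commute with Fourier series without
  any appeal to Fubini's theorem.
\<close>

definition torus_average :: "(real \<Rightarrow> real) \<Rightarrow> nat \<Rightarrow> real" where
  "torus_average g P = (\<Sum>t<P. g (2 * pi * real t / real P)) / real P"

text \<open>
  A nontrivial character sums to zero over the \<open>P\<close>-th roots of unity, and the character
  with frequency \<open>j \<noteq> 0\<close> is nontrivial there as soon as \<open>P > \<bar>j\<bar>\<close>.
\<close>

lemma torus_average_cos_tendsto:
  "torus_average (\<lambda>x. cos (of_int j * x)) \<longlonglongrightarrow> (if j = 0 then 1 else 0)"
proof (rule tendsto_eventually, rule eventually_sequentiallyI)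
  fix P :: nat assume P: "nat \<bar>j\<bar> + 1 \<le> P"
  show "torus_average (\<lambda>x. cos (of_int j * x)) P = (if j = 0 then 1 else 0)"
  proof (cases "j = 0")
    case True
    then show ?thesis using P by (simp add: torus_average_def)
  next
    case False
    define w where "w = cis (2 * pi * of_int j / real P)"
    have "w \<noteq> 1"
    proof
      assume "w = 1"
      then have "cos (2 * pi * of_int j / real P) = 1"
        by (simp add: w_def complex_eq_iff)
      then obtain n :: int where "2 * pi * of_int j / real P = of_int n * 2 * pi"
        by (auto simp: cos_one_2pi_int)
      then have "real_of_int j = of_int (n * int P)"
        using P by (simp add: field_simps)
      then have "j = n * int P"
        by linarith
      then have "int P dvd j"
        by simp
      with False have "int P \<le> \<bar>j\<bar>"
        using dvd_imp_le_int[of j "int P"] by simp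
      with P show False
        by linarith
    qed
    moreover have "w ^ P = 1"
    proof -
      have "w ^ P = cis (real P * (2 * pi * of_int j / real P))"
        by (simp only: w_def Complex.DeMoivre)
      also have "\<dots> = cis (2 * pi * of_int j)"
        using P by simp
      also have "\<dots> = 1"
        by (simp add: complex_eq_iff)
      finally show ?thesis .
    qed
    moreover have "(\<Sum>t<P. w ^ t) * (1 - w) = 1 - w ^ P"
      by (metis mult.commute one_diff_power_eq)
    ultimately have "(\<Sum>t<P. w ^ t) = 0"
      by simp
    then have "(\<Sum>t<P. Re (w ^ t)) = 0"
      by (metis Re_sum zero_complex.simps(1))
    then show ?thesis
      using False by (simp add: torus_average_def w_def Complex.DeMoivre mult_ac)
  qed
qed

text \<open>
  Exchanging average and series leaves the average of \<open>cos (m x) cos (k x)\<close> as coefficient of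
  \<open>f m\<close>.  In the limit only \<open>m = k\<close> and \<open>m = - k\<close> survive, each with weight \<open>1/2\<close>
  (both weights fall on the same term when \<open>k = 0\<close>), and symmetry of \<open>f\<close> adds them up to \<open>f k\<close>.
\<close>

lemma fourier_inversion:
  assumes f: "f \<in> L1_sym"
  shows "torus_average (\<lambda>x. (\<Sum>\<^sub>\<infinity>m. f m * cos (of_int m * x)) * cos (of_int k * x))
           \<longlonglongrightarrow> f k"
proof -
  define c where "c P m = torus_average (\<lambda>x. cos (of_int m * x) * cos (of_int k * x)) P"
    for P and m :: int
  have c_split: "c P m = (torus_average (\<lambda>x. cos (of_int (m - k) * x)) P
      + torus_average (\<lambda>x. cos (of_int (m + k) * x)) P) / 2" for P m
    by (simp add: c_def torus_average_def cos_times_cos left_diff_distrib distrib_right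
        sum.distrib add_divide_distrib flip: sum_divide_distrib)
  have lim: "(\<lambda>P. c P m) \<longlonglongrightarrow> ((if m = k then 1 else 0) + (if m = - k then 1 else 0)) / 2" for m
  proof -
    have "(\<lambda>P. c P m) \<longlonglongrightarrow> ((if m - k = 0 then 1 else 0) + (if m + k = 0 then 1 else 0)) / 2"
      unfolding c_split by (intro tendsto_intros torus_average_cos_tendsto) auto
    then show ?thesis
      by (simp add: eq_neg_iff_add_eq_0)
  qed
  have bound: "\<bar>c P m\<bar> \<le> 1" for P m
  proof -
    have "\<bar>\<Sum>t<P. cos (of_int m * (2 * pi * real t / real P)) * cos (of_int k * (2 * pi * real t / real P))\<bar>
       \<le> (\<Sum>t<P. 1)"
      by (rule order.trans[OF sum_abs sum_mono]) (simp add: abs_mult mult_le_one)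
    then show ?thesis
      by (cases "P = 0") (simp_all add: c_def torus_average_def)
  qed
  have avg_eq: "torus_average (\<lambda>x. (\<Sum>\<^sub>\<infinity>m. f m * cos (of_int m * x)) * cos (of_int k * x)) P
      = (\<Sum>\<^sub>\<infinity>m. f m * c P m)" for P
  proof -
    define x where "x t = 2 * pi * real t / real P" for t
    have s: "((\<lambda>m. f m * cos (of_int m * x t)) has_sum (\<Sum>\<^sub>\<infinity>m. f m * cos (of_int m * x t))) UNIV"
      for t
      by (intro has_sum_infsum summable_on_mult_bounded[where B = 1] L1_symD[OF f]) auto
    have avg: "((\<lambda>m. (\<Sum>t<P. f m * cos (of_int m * x t) * cos (of_int k * x t)) * inverse (real P)) has_sum
        ((\<Sum>t<P. (\<Sum>\<^sub>\<infinity>m. f m * cos (of_int m * x t)) * cos (of_int k * x t)) * inverse (real P))) UNIV"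
      by (intro has_sum_cmult_left has_sum_finite_sum s)
    have "(\<Sum>t<P. (\<Sum>\<^sub>\<infinity>m. f m * cos (of_int m * x t)) * cos (of_int k * x t)) / real P
       = (\<Sum>\<^sub>\<infinity>m. (\<Sum>t<P. f m * cos (of_int m * x t) * cos (of_int k * x t)) / real P)"
      by (simp only: divide_inverse infsumI[OF avg])
    also have "\<dots> = (\<Sum>\<^sub>\<infinity>m. f m * c P m)"
      by (simp add: c_def torus_average_def x_def sum_distrib_left mult.assoc)
    finally show ?thesis
      by (simp add: torus_average_def x_def)
  qed
  have "(\<Sum>\<^sub>\<infinity>m. f m * (((if m = k then 1 else 0) + (if m = - k then 1 else 0)) / 2)) = f k"
  proof -
    have "(\<Sum>\<^sub>\<infinity>m. f m * (((if m = k then 1 else 0) + (if m = - k then 1 else 0)) / 2))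
       = (\<Sum>\<^sub>\<infinity>m\<in>{k, - k}. f m * (((if m = k then 1 else 0) + (if m = - k then 1 else 0)) / 2))"
      by (rule infsum_cong_neutral) auto
    then show ?thesis
      by (cases "k = 0") (auto simp: L1_symD(1)[OF f])
  qed
  moreover have "(\<lambda>P. \<Sum>\<^sub>\<infinity>m. f m * c P m) \<longlonglongrightarrow>
      (\<Sum>\<^sub>\<infinity>m. f m * (((if m = k then 1 else 0) + (if m = - k then 1 else 0)) / 2))"
    by (rule infsum_tannery[OF L1_symD(2)[OF f] bound lim])
  moreover have "torus_average (\<lambda>x. (\<Sum>\<^sub>\<infinity>m. f m * cos (of_int m * x)) * cos (of_int k * x))
      = (\<lambda>P. \<Sum>\<^sub>\<infinity>m. f m * c P m)"
    by (rule ext) (rule avg_eq)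
  ultimately show ?thesis
    by simp
qed

text \<open>
  Parseval's identity for a trigonometric polynomial: by inversion, the pairing is a limit of
  averages of the product of two nonnegative functions.
\<close>

lemma cone_P_pairing_nonneg:
  assumes f: "f \<in> cone_P" and "finite A"
    and nn: "\<And>x. 0 \<le> (\<Sum>a\<in>A. c a * cos (of_int (n a) * x))"
  shows "0 \<le> (\<Sum>a\<in>A. c a * f (n a))"
proof -
  let ?F = "\<lambda>x. \<Sum>\<^sub>\<infinity>m. f m * cos (of_int m * x)"
  have F: "f \<in> L1_sym" "0 \<le> ?F x" for x
    using f by (auto simp: cone_P_iff_cosine_series)
  have "(\<lambda>P. \<Sum>a\<in>A. c a * torus_average (\<lambda>x. ?F x * cos (of_int (n a) * x)) P)
      \<longlonglongrightarrow> (\<Sum>a\<in>A. c a * f (n a))"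
    by (intro tendsto_intros fourier_inversion F)
  moreover have "0 \<le> (\<Sum>a\<in>A. c a * torus_average (\<lambda>x. ?F x * cos (of_int (n a) * x)) P)" for P
  proof -
    have "(\<Sum>a\<in>A. c a * torus_average (\<lambda>x. ?F x * cos (of_int (n a) * x)) P)
      = torus_average (\<lambda>x. ?F x * (\<Sum>a\<in>A. c a * cos (of_int (n a) * x))) P"
      unfolding torus_average_def sum_divide_distrib sum_distrib_left
      by (subst sum.swap) (simp add: mult_ac)
    also have "0 \<le> \<dots>"
      unfolding torus_average_def by (intro divide_nonneg_nonneg sum_nonneg mult_nonneg_nonneg nn F) auto
    finally show ?thesis .
  qed
  ultimately show ?thesis
    by (intro LIMSEQ_le_const) auto
qed

text \<open>
  Apply the pairing to the nonnegative polynomial \<open>1 - cos (k x)\<close>.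
\<close>

lemma cone_P_le_at_0:
  assumes "f \<in> cone_P"
  shows "f k \<le> f 0"
  using cone_P_pairing_nonneg[OF assms, of "{0::nat, 1}" "\<lambda>i. if i = 0 then 1 else - 1" "\<lambda>i. if i = 0 then 0 else k"]
  by simp

section \<open>Positive definite functions\<close>

lemma positive_definiteD:
  fixes m :: nat and n :: "nat \<Rightarrow> int"
  assumes "positive_definite h" "m \<ge> 1"
  shows "(\<Sum>i=1..m. \<Sum>j=1..m. z i * cnj (z j) * complex_of_real (h (n i - n j))) \<in> \<real>\<^sub>\<ge>\<^sub>0"
  using assms(1)[unfolded positive_definite_def, rule_format, OF assms(2)] .

text \<open>
  The choice \<open>z\<^sub>i = exp (\<i> n\<^sub>i x)\<close> turns positive definiteness into a sign condition on
  trigonometric polynomials, which is the form in which it can be paired with \<open>cone_P\<close>.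
\<close>

lemma positive_definite_cosine_sum_nonneg:
  fixes m :: nat and n :: "nat \<Rightarrow> int"
  assumes "positive_definite h" and "m \<ge> 1"
  shows "0 \<le> (\<Sum>i=1..m. \<Sum>j=1..m. h (n i - n j) * cos (of_int (n i - n j) * x))"
proof -
  have "0 \<le> Re (\<Sum>i=1..m. \<Sum>j=1..m. cis (of_int (n i) * x) * cnj (cis (of_int (n j) * x))
            * complex_of_real (h (n i - n j)))"
    using positive_definiteD[OF assms, of "\<lambda>i. cis (of_int (n i) * x)"]
    by (simp only: complex_nonneg_Reals_iff)
  also have "\<dots> = (\<Sum>i=1..m. \<Sum>j=1..m. h (n i - n j) * cos (of_int (n i - n j) * x))"
    by (simp add: cos_diff right_diff_distrib mult.commute)
  finally show ?thesis .
qed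

text \<open>
  Positivity of the Toeplitz form at the points \<open>k, 0\<close> with coefficients \<open>1, 1\<close> and \<open>1, - 1\<close>.
\<close>

lemma positive_definite_bound:
  assumes pd: "positive_definite h" and sym: "\<And>k. h (- k) = h k"
  shows "\<bar>h k\<bar> \<le> h 0"
proof -
  have "0 \<le> 2 * h 0 + 2 * s * h k" if "s = 1 \<or> s = - 1" for s :: real
  proof -
    have "(\<Sum>i=1..2. \<Sum>j=1..2. (if i = 1 then 1 else of_real s) * cnj (if j = 1 then 1 else of_real s)
        * complex_of_real (h ((if i = (1::nat) then k else 0) - (if j = (1::nat) then k else 0)))) \<in> \<real>\<^sub>\<ge>\<^sub>0"
      by (rule positive_definiteD[OF pd]) simp
    then show ?thesis
      using that by (auto simp: numeral_2_eq_2 complex_nonneg_Reals_iff sym)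
  qed
  from this[of 1] this[of "- 1"] show ?thesis
    by auto
qed

lemma positive_definite_add_scaled:
  assumes "positive_definite g" "positive_definite h" "0 \<le> a" "0 \<le> b"
  shows "positive_definite (\<lambda>k. a * g k + b * h k)"
  unfolding positive_definite_def
proof (intro allI impI)
  fix m :: nat and n :: "nat \<Rightarrow> int" and z :: "nat \<Rightarrow> complex"
  assume m: "1 \<le> m"
  have "(\<Sum>i=1..m. \<Sum>j=1..m. z i * cnj (z j) * complex_of_real (a * g (n i - n j) + b * h (n i - n j)))
     = of_real a * (\<Sum>i=1..m. \<Sum>j=1..m. z i * cnj (z j) * complex_of_real (g (n i - n j)))
     + of_real b * (\<Sum>i=1..m. \<Sum>j=1..m. z i * cnj (z j) * complex_of_real (h (n i - n j)))"
    by (simp add: sum_distrib_left sum.distrib algebra_simps)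
  also have "\<dots> \<in> \<real>\<^sub>\<ge>\<^sub>0"
    using assms by (intro nonneg_Reals_add_I nonneg_Reals_mult_I positive_definiteD m) auto
  finally show "(\<Sum>i=1..m. \<Sum>j=1..m. z i * cnj (z j)
      * complex_of_real (a * g (n i - n j) + b * h (n i - n j))) \<in> \<real>\<^sub>\<ge>\<^sub>0" .
qed

text \<open>
  The cosine is the mean of the characters \<open>exp (\<i> k x)\<close> and \<open>exp (- \<i> k x)\<close>; the
  Toeplitz form of a character is the squared modulus of a single sum.
\<close>

lemma positive_definite_cos: "positive_definite (\<lambda>k. cos (of_int k * x))"
  unfolding positive_definite_def
proof (intro allI impI)
  fix m :: nat and n :: "nat \<Rightarrow> int" and z :: "nat \<Rightarrow> complex"
  define u v where "u = (\<Sum>i=1..m. z i * cis (of_int (n i) * x))"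
    and "v = (\<Sum>i=1..m. z i * cis (- (of_int (n i) * x)))"
  have cos_eq: "2 * complex_of_real (cos (a - b)) = cis a * cis (- b) + cis (- a) * cis b" for a b
    by (simp add: complex_eq_iff cos_diff)
  have "u * cnj u + v * cnj v = (\<Sum>i=1..m. \<Sum>j=1..m.
      z i * cnj (z j) * (2 * complex_of_real (cos (of_int (n i - n j) * x))))"
    by (simp add: u_def v_def sum_product cis_cnj cos_eq right_diff_distrib distrib_left mult_ac
        flip: sum.distrib)
  also have "\<dots> = 2 * (\<Sum>i=1..m. \<Sum>j=1..m. z i * cnj (z j) * complex_of_real (cos (of_int (n i - n j) * x)))"
    by (simp only: sum_distrib_left mult_ac)
  finally have "(\<Sum>i=1..m. \<Sum>j=1..m. z i * cnj (z j) * complex_of_real (cos (of_int (n i - n j) * x)))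
      = (u * cnj u + v * cnj v) / 2"
    by simp
  also have "\<dots> = complex_of_real (((cmod u)\<^sup>2 + (cmod v)\<^sup>2) / 2)"
    by (simp only: of_real_divide of_real_add complex_norm_square of_real_numeral)
  also have "\<dots> \<in> \<real>\<^sub>\<ge>\<^sub>0"
    by (simp only: nonneg_Reals_of_real_iff) simp
  finally show "(\<Sum>i=1..m. \<Sum>j=1..m. z i * cnj (z j)
      * complex_of_real (cos (of_int (n i - n j) * x))) \<in> \<real>\<^sub>\<ge>\<^sub>0" .
qed

text \<open>
  Since \<open>\<bar>h k\<bar> \<le> h 0\<close> for positive definite \<open>h\<close>, the single constraint \<open>h 0 \<le> C\<close> confines
  \<open>h\<close> to the ball of radius \<open>C\<close> in \<open>L\<^sup>\<infinity>\<close>; this is what makes the set compact for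
  pointwise convergence.
\<close>

definition pd_ball :: "real \<Rightarrow> (int \<Rightarrow> real) set" where
  "pd_ball C = {h. (\<forall>k. h (- k) = h k) \<and> positive_definite h \<and> h 0 \<le> C}"

lemma pd_ball_bound: "h \<in> pd_ball C \<Longrightarrow> \<bar>h k\<bar> \<le> C"
  using positive_definite_bound[of h k] by (auto simp: pd_ball_def)

lemma scaled_cos_in_pd_ball: "0 \<le> c \<Longrightarrow> c \<le> C \<Longrightarrow> (\<lambda>k. c * cos (of_int k * x)) \<in> pd_ball C"
  using positive_definite_add_scaled[OF positive_definite_cos positive_definite_cos, of c 0 x x]
  by (auto simp: pd_ball_def)

lemma pd_ball_convex:
  assumes "g \<in> pd_ball C" "h \<in> pd_ball C" "0 \<le> t" "t \<le> 1"
  shows "(\<lambda>k. g k + t * (h k - g k)) \<in> pd_ball C"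
proof -
  have eq: "(\<lambda>k. g k + t * (h k - g k)) = (\<lambda>k. (1 - t) * g k + t * h k)"
    by (simp add: algebra_simps)
  have "(1 - t) * g 0 + t * h 0 \<le> C"
    using assms by (intro convex_bound_le) (auto simp: pd_ball_def)
  then show ?thesis
    unfolding eq using assms by (auto simp: pd_ball_def intro!: positive_definite_add_scaled)
qed

text \<open>
  The topology on \<^typ>\<open>int \<Rightarrow> real\<close> is that of pointwise convergence.  Every defining
  condition is closed and involves finitely many coordinates, and the set lies in the cube
  \<open>[- C, C]\<^sup>\<int>\<close>, which is compact by Tychonoff's theorem.
\<close>

lemma compact_pd_ball: "compact (pd_ball C)"
proof -
  have cont: "continuous_on UNIV (\<lambda>h. \<Sum>i=1..m. \<Sum>j=1..m.
      z i * cnj (z j) * complex_of_real (h (n i - n j)))" for m z and n :: "nat \<Rightarrow> int"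
    by (intro continuous_intros continuous_on_product_coordinates)
  have "closed (pd_ball C)"
    unfolding pd_ball_def positive_definite_def
    by (intro closed_Collect_conj closed_Collect_all closed_Collect_imp open_Collect_const
        closed_Collect_eq closed_Collect_le continuous_on_product_coordinates continuous_on_const
        closed_vimage[OF closed_nonneg_Reals_complex cont, unfolded vimage_def])
  moreover have "compact (PiE UNIV (\<lambda>_::int. {- C..C}))"
    using compactin_PiE[of "\<lambda>_::int. euclidean :: real topology" UNIV "\<lambda>_. {- C..C}"]
    by (simp add: euclidean_product_topology)
  moreover have "pd_ball C \<subseteq> PiE UNIV (\<lambda>_. {- C..C})"
    using pd_ball_bound by (auto simp: abs_le_iff minus_le_iff)
  ultimately show ?thesis
    by (metis closed_Int_compact inf.absorb1)
qed

section \<open>Weak duality\<close>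

text \<open>
  Passing from the square of side \<open>m\<close> to that of side \<open>m + 1\<close> adds one row, one column and
  the corner; the differences met there are exactly \<open>- m, \<dots>, m\<close>.
\<close>

lemma square_sum_eq_sum_symmetric_sums:
  fixes g :: "int \<Rightarrow> 'a :: comm_semiring_1"
  assumes "\<And>k. g (- k) = g k"
  shows "(\<Sum>i=1..m. \<Sum>j=1..m. g (int i - int j)) = (\<Sum>r<m. \<Sum>k=- int r..int r. g k)"
proof (induction m)
  case (Suc m)
  have row: "(\<Sum>j=1..m. g (int (Suc m) - int j)) = (\<Sum>k=1..int m. g k)"
    by (rule sum.reindex_bij_witness[where i = "\<lambda>k. nat (int (Suc m) - k)" and j = "\<lambda>j. int (Suc m) - int j"]) auto
  have col: "(\<Sum>i=1..m. g (int i - int (Suc m))) = (\<Sum>k=- int m..-1. g k)"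
    by (rule sum.reindex_bij_witness[where i = "\<lambda>k. nat (int (Suc m) + k)" and j = "\<lambda>j. int j - int (Suc m)"]) auto
  have "{- int m..int m} = {- int m..-1} \<union> insert 0 {1..int m}"
    by auto
  then have split: "(\<Sum>k=- int m..int m. g k) = (\<Sum>k=- int m..-1. g k) + (g 0 + (\<Sum>k=1..int m. g k))"
    by (simp add: sum.union_disjoint add_ac)
  show ?case
    using Suc by (simp add: sum.distrib row col split add_ac del: of_nat_Suc One_nat_def)
qed simp

text \<open>
  A finite form of the Schur product theorem: \<open>(h (i - j) f (i - j))\<close> is paired with the all-ones
  vector.  The sums over squares are unnormalised Fejer sums of \<open>\<Sum> f h\<close>, and they stay
  nonnegative although the symmetric partial sums themselves need not be.
\<close>

lemma pairing_cesaro_nonneg: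
  assumes f: "f \<in> cone_P" and pd: "positive_definite h" and sym: "\<And>k. h (- k) = h k"
  shows "0 \<le> (\<Sum>r<m. \<Sum>k=- int r..int r. f k * h k)"
proof (cases "m \<ge> 1")
  case True
  have f_sym: "f (- k) = f k" for k
    using f by (auto simp: cone_P_def L1_sym_def)
  have "0 \<le> (\<Sum>(i,j)\<in>{1..m}\<times>{1..m}. h (int i - int j) * f (int i - int j))"
    using cone_P_pairing_nonneg[OF f, of "{1..m}\<times>{1..m}" "\<lambda>(i,j). h (int i - int j)" "\<lambda>(i,j). int i - int j"]
      positive_definite_cosine_sum_nonneg[OF pd True, of int]
    by (simp add: case_prod_beta sum.cartesian_product)
  also have "\<dots> = (\<Sum>i=1..m. \<Sum>j=1..m. f (int i - int j) * h (int i - int j))"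
    by (simp add: sum.cartesian_product mult.commute)
  also have "\<dots> = (\<Sum>r<m. \<Sum>k=- int r..int r. f k * h k)"
    by (rule square_sum_eq_sum_symmetric_sums) (simp add: sym f_sym)
  finally show ?thesis .
qed (simp add: not_le)

text \<open>
  If \<open>R\<close> were negative, the sums of \<open>d\<close> would drift to \<open>- \<infinity>\<close>.  This replaces the
  passage from Cesaro means to the limit.
\<close>

lemma nonneg_if_partial_sums_nonneg:
  fixes d :: "nat \<Rightarrow> real"
  assumes S: "\<And>m. 0 \<le> (\<Sum>r<m. d r)" and le: "\<And>r. r \<ge> M \<Longrightarrow> d r \<le> R"
  shows "0 \<le> R"
proof (rule ccontr)
  assume R: "\<not> 0 \<le> R"
  obtain n :: nat where n: "(\<Sum>r<M. d r) < real n * - R"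
    using R ex_less_of_nat_mult[of "- R"] by auto
  have "(\<Sum>r<M + j. d r) \<le> (\<Sum>r<M. d r) + real j * R" for j
  proof (induction j)
    case (Suc j)
    then show ?case
      using le[of "M + j"] by (simp add: algebra_simps)
  qed simp
  from this[of n] S[of "M + n"] n show False
    by simp
qed

text \<open>
  Weak duality.  A feasible \<open>h\<close> is dominated by the finitely supported function
  \<open>e = (h 0 + 1) \<chi>\<^bsub>[- N, N]\<^esub> - \<chi>\<^bsub>[- M, M]\<^esub>\<close>: inside \<open>[- N, N]\<close> because \<open>h k \<le> h 0\<close>, outside by
  feasibility.  As \<open>f \<ge> 0\<close>, every long symmetric partial sum of \<open>f h\<close> is at most the pairing
  of \<open>f\<close> with \<open>e\<close>, and averaging these sums forces that pairing to be nonnegative.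
\<close>

lemma dual_certificate_bound:
  fixes N M :: nat
  assumes f: "f \<in> cone_C \<inter> cone_P" and NM: "N \<le> M"
    and pd: "positive_definite h" and sym: "\<And>k. h (- k) = h k"
    and h: "\<And>k. \<bar>k\<bar> > int N \<Longrightarrow> h k \<le> - indicator {- int M..int M} k"
  shows "(\<Sum>k=- int M..int M. f k) \<le> (h 0 + 1) * (\<Sum>k=- int N..int N. f k)"
proof -
  have f_nonneg: "0 \<le> f k" for k
    using f by (simp add: cone_C_def)
  define e :: "int \<Rightarrow> real" where
    "e k = (if \<bar>k\<bar> \<le> int N then h 0 + 1 else 0) - indicator {- int M..int M} k" for k
  have e: "h k \<le> e k" for k
    using h[of k] positive_definite_bound[OF pd sym, of k] NM
    by (auto simp: e_def indicator_def split: if_splits)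
  have "0 \<le> (\<Sum>k=- int M..int M. f k * e k)"
  proof (rule nonneg_if_partial_sums_nonneg)
    show "0 \<le> (\<Sum>r<m. \<Sum>k=- int r..int r. f k * h k)" for m
      using f by (intro pairing_cesaro_nonneg pd sym) auto
    fix r assume r: "M \<le> r"
    have "(\<Sum>k=- int r..int r. f k * h k) \<le> (\<Sum>k=- int r..int r. f k * e k)"
      by (intro sum_mono mult_left_mono e f_nonneg)
    also have "\<dots> = (\<Sum>k=- int M..int M. f k * e k)"
      using r NM by (intro sum.mono_neutral_right) (auto simp: e_def)
    finally show "(\<Sum>k=- int r..int r. f k * h k) \<le> (\<Sum>k=- int M..int M. f k * e k)" .
  qed
  also have "\<dots> = (\<Sum>k=- int M..int M. f k * (if \<bar>k\<bar> \<le> int N then h 0 + 1 else 0)) - (\<Sum>k=- int M..int M. f k)"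
    by (simp add: e_def right_diff_distrib sum_subtractf)
  also have "(\<Sum>k=- int M..int M. f k * (if \<bar>k\<bar> \<le> int N then h 0 + 1 else 0))
      = (\<Sum>k=- int N..int N. f k * (h 0 + 1))"
    using NM by (intro sum.mono_neutral_cong_right) auto
  finally show ?thesis
    by (simp add: mult.commute flip: sum_distrib_right)
qed

section \<open>Strong duality\<close>

lemma summable_on_geometric_int: "(\<lambda>k::int. (1/2::real) ^ nat \<bar>k\<bar>) summable_on UNIV"
proof -
  have geo: "(\<lambda>n::nat. (1/2::real) ^ n) summable_on UNIV"
    by (rule norm_summable_imp_summable_on) (simp add: power_abs summable_geometric)
  have "(\<lambda>k::int. (1/2::real) ^ nat \<bar>k\<bar>) summable_on (range int)"
    by (subst summable_on_reindex) (use geo in \<open>auto simp: o_def\<close>)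
  moreover have "(\<lambda>k::int. (1/2::real) ^ nat \<bar>k\<bar>) summable_on (range (\<lambda>n. - int n - 1))"
  proof (subst summable_on_reindex)
    show "((\<lambda>k::int. (1/2::real) ^ nat \<bar>k\<bar>) \<circ> (\<lambda>n. - int n - 1)) summable_on UNIV"
    proof (rule summable_on_comparison_test[OF geo])
      show "((\<lambda>k. (1/2::real) ^ nat \<bar>k\<bar>) \<circ> (\<lambda>n. - int n - 1)) n \<le> (1/2) ^ n" for n
        by (auto intro!: power_decreasing)
    qed auto
  qed (auto intro: injI)
  ultimately have "(\<lambda>k::int. (1/2::real) ^ nat \<bar>k\<bar>) summable_on (range int \<union> range (\<lambda>n. - int n - 1))"
    by (rule summable_on_Un_disjoint) auto
  moreover have "k \<in> range int \<union> range (\<lambda>n. - int n - 1)" for k :: int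
    using rangeI[of int "nat k"] rangeI[of "\<lambda>n. - int n - 1" "nat (- k - 1)"] by (cases "k \<ge> 0") auto
  ultimately show ?thesis
    by (metis UNIV_eq_I)
qed

text \<open>
  Strong duality.  The certificate is found by minimising, over the compact set \<open>pd_ball C\<close>, the
  weighted squared violation \<open>Q h\<close> of the constraints outside \<open>[- N, N]\<close>.  The gradient of \<open>Q\<close>
  at a minimiser \<open>g\<close> is \<open>2 f\<close> for a nonnegative summable function \<open>f\<close> vanishing on \<open>[- N, N]\<close>, and
  the first-order condition says that \<open>g\<close> minimises the linear functional \<open>\<Sum> f h\<close> on
  \<open>pd_ball C\<close>.  Testing it against \<open>h = 0\<close> and \<open>h = C cos (k x)\<close> shows that \<open>f\<close> plus a
  suitable mass \<open>a\<close> at \<open>0\<close> belongs to both cones.  The hypothesis on \<open>C\<close>, applied to this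
  function, reads \<open>\<Sum> f (g + ind) \<le> 0\<close>, where \<open>ind\<close> is the indicator of \<open>[- M, M]\<close>.  But the left-hand side is \<open>Q g\<close>, so \<open>g\<close> violates
  nothing.
\<close>

lemma dual_certificate_exists:
  fixes C :: real and N M :: int
  assumes C: "C > 0" and M: "0 \<le> M" and N: "0 \<le> N"
    and adm: "\<And>f. f \<in> cone_C \<inter> cone_P \<Longrightarrow> (\<Sum>k=-M..M. f k) \<le> (C + 1) * (\<Sum>k=-N..N. f k)"
  shows "\<exists>h\<in>pd_ball C. \<forall>k. \<bar>k\<bar> > N \<longrightarrow> h k \<le> - indicator {-M..M} k"
proof -
  \<comment> \<open>The weights make the violation a uniformly convergent, hence continuous, series on
    \<open>pd_ball C\<close>, and the gradient summable; they vanish where \<open>h\<close> is unconstrained.\<close>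
  define w :: "int \<Rightarrow> real" where "w k = (if \<bar>k\<bar> \<le> N then 0 else (1/2) ^ nat \<bar>k\<bar>)" for k
  define ind :: "int \<Rightarrow> real" where "ind = indicator {-M..M}"
  define p where "p h k = max (h k + ind k) 0" for h k
  define Q where "Q h = (\<Sum>\<^sub>\<infinity>k. w k * (p h k)\<^sup>2)" for h
  have w_nonneg: "0 \<le> w k" and w_sym: "w (- k) = w k" for k
    by (auto simp: w_def)
  have w_summable: "w summable_on UNIV"
    by (rule summable_on_comparison_test[OF summable_on_geometric_int]) (auto simp: w_def)
  have w_mult: "(\<lambda>k. w k * e k) summable_on UNIV" if "\<And>k. \<bar>e k\<bar> \<le> B" for e B
    using w_summable that by (intro summable_on_mult_bounded) (simp_all add: w_nonneg)
  have ind: "0 \<le> ind k" "ind k \<le> 1" "ind (- k) = ind k" for k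
    by (auto simp: ind_def indicator_def)
  have p_nonneg: "0 \<le> p h k" for h k
    by (simp add: p_def)
  have p_bound: "p h k \<le> C + 1" if "h \<in> pd_ball C" for h k
    using pd_ball_bound[OF that, of k] ind[of k] C by (auto simp: p_def)
  have p2_bound: "\<bar>(p h k)\<^sup>2\<bar> \<le> (C + 1)\<^sup>2" if "h \<in> pd_ball C" for h k
    using p_bound[OF that] p_nonneg by (simp add: power_mono)
  have "continuous_on (pd_ball C) Q"
    unfolding Q_def
  proof (rule uniform_limit_theorem)
    show "uniform_limit (pd_ball C) (\<lambda>X h. \<Sum>k\<in>X. w k * (p h k)\<^sup>2) (\<lambda>h. \<Sum>\<^sub>\<infinity>k. w k * (p h k)\<^sup>2)
        (finite_subsets_at_top UNIV)"
      by (rule Weierstrass_m_test_general[where M = "\<lambda>k. w k * (C + 1)\<^sup>2"])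
        (use p2_bound w_nonneg w_summable in
          \<open>auto simp: abs_mult intro!: mult_left_mono summable_on_cmult_left\<close>)
    show "\<forall>\<^sub>F X in finite_subsets_at_top UNIV. continuous_on (pd_ball C) (\<lambda>h. \<Sum>k\<in>X. w k * (p h k)\<^sup>2)"
      unfolding p_def
      by (intro always_eventually allI continuous_intros
          continuous_on_subset[OF continuous_on_product_coordinates]) auto
  qed simp
  moreover have zero: "(\<lambda>_. 0) \<in> pd_ball C"
    using scaled_cos_in_pd_ball[of 0 C 0] C by simp
  ultimately obtain g where g: "g \<in> pd_ball C" and g_min: "\<And>h. h \<in> pd_ball C \<Longrightarrow> Q g \<le> Q h"
    using continuous_attains_inf[OF compact_pd_ball, of C Q] by auto
  define f where "f k = w k * p g k" for k
  have f_summable: "f summable_on UNIV"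
    unfolding f_def using p_bound[OF g] p_nonneg by (intro w_mult) (simp add: abs_of_nonneg)
  have f_nonneg: "0 \<le> f k" and f_sym: "f (- k) = f k" for k
    using g by (auto simp: f_def p_def w_sym w_nonneg ind pd_ball_def)
  have f_inside: "f k = 0" if "\<bar>k\<bar> \<le> N" for k
    using that by (simp add: f_def w_def)
  have f_mult: "(\<lambda>k. f k * e k) summable_on UNIV" if "\<And>k. \<bar>e k\<bar> \<le> B" for e B
    using f_summable that by (intro summable_on_mult_bounded) (simp_all add: f_nonneg)
  \<comment> \<open>Move from \<open>g\<close> towards \<open>h\<close> by a step \<open>t\<close>: \<open>Q\<close> changes by at most \<open>2 t S + t\<^sup>2 W\<close>, and this
    cannot be negative for small \<open>t\<close>.\<close>
  have first_order: "(\<Sum>\<^sub>\<infinity>k. f k * g k) \<le> (\<Sum>\<^sub>\<infinity>k. f k * h k)" if h: "h \<in> pd_ball C" for h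
  proof -
    define d where "d k = h k - g k" for k
    define S where "S = (\<Sum>\<^sub>\<infinity>k. f k * d k)"
    define W where "W = (\<Sum>\<^sub>\<infinity>k. w k * (d k)\<^sup>2)"
    have d_bound: "\<bar>d k\<bar> \<le> 2 * C" for k
      using pd_ball_bound[OF h, of k] pd_ball_bound[OF g, of k] by (simp add: d_def)
    have W_nonneg: "0 \<le> W"
      unfolding W_def by (intro infsum_nonneg mult_nonneg_nonneg w_nonneg) auto
    have d2_bound: "\<bar>(d k)\<^sup>2\<bar> \<le> (2 * C)\<^sup>2" for k
      using power_mono[OF d_bound[of k], of 2] by simp
    have ineq: "0 \<le> 2 * S + t * W" if t: "0 < t" "t \<le> 1" for t
    proof -
      let ?h = "\<lambda>k. g k + t * d k"
      have h': "?h \<in> pd_ball C"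
        unfolding d_def using pd_ball_convex[OF g h] t by simp
      have rhs: "((\<lambda>k. w k * (p g k)\<^sup>2 + (2 * t) * (f k * d k) + t\<^sup>2 * (w k * (d k)\<^sup>2))
          has_sum (Q g + (2 * t) * S + t\<^sup>2 * W)) UNIV"
        unfolding Q_def S_def W_def
        by (intro has_sum_add has_sum_cmult_right has_sum_infsum w_mult[OF p2_bound[OF g]]
            f_mult[OF d_bound] w_mult[OF d2_bound])
      have lhs: "((\<lambda>k. w k * (p ?h k)\<^sup>2) has_sum Q ?h) UNIV"
        unfolding Q_def by (intro has_sum_infsum w_mult[OF p2_bound[OF h']])
      have "Q ?h \<le> Q g + (2 * t) * S + t\<^sup>2 * W"
      proof (rule has_sum_mono[OF lhs rhs])
        fix k
        have "(p ?h k)\<^sup>2 \<le> (p g k + t * d k)\<^sup>2"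
          \<comment> \<open>For real \<open>y\<close> and \<open>s\<close>, the positive part of \<open>y + s\<close> is at most \<open>\<bar>max y 0 + s\<bar>\<close>.\<close>
          unfolding p_def by (cases "g k + t * d k + ind k \<le> 0") (auto intro!: power_mono)
        then have "w k * (p ?h k)\<^sup>2 \<le> w k * (p g k + t * d k)\<^sup>2"
          by (intro mult_left_mono w_nonneg)
        also have "\<dots> = w k * (p g k)\<^sup>2 + (2 * t) * (f k * d k) + t\<^sup>2 * (w k * (d k)\<^sup>2)"
          by (simp add: f_def power2_eq_square algebra_simps)
        finally show "w k * (p ?h k)\<^sup>2
            \<le> w k * (p g k)\<^sup>2 + (2 * t) * (f k * d k) + t\<^sup>2 * (w k * (d k)\<^sup>2)" .
      qed
      with g_min[OF h'] have "0 \<le> t * (2 * S + t * W)"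
        by (simp add: power2_eq_square algebra_simps)
      with t show ?thesis
        by (simp add: zero_le_mult_iff)
    qed
    have "0 \<le> S"
    proof (rule ccontr)
      assume S: "\<not> 0 \<le> S"
      define t where "t = min 1 (- S / (W + 1))"
      have t: "0 < t" "t \<le> 1"
        using S W_nonneg by (auto simp: t_def divide_neg_pos)
      have "t * W \<le> - S / (W + 1) * (W + 1)"
        using S W_nonneg t by (intro mult_mono) (auto simp: t_def)
      also have "\<dots> = - S"
        using W_nonneg by simp
      finally show False
        using ineq[OF t] S by simp
    qed
    moreover have "(\<Sum>\<^sub>\<infinity>k. f k * g k + f k * d k) = (\<Sum>\<^sub>\<infinity>k. f k * g k) + S"
      unfolding S_def by (intro infsum_add f_mult[OF pd_ball_bound[OF g]] f_mult[OF d_bound])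
    moreover have "f k * g k + f k * d k = f k * h k" for k
      by (simp add: d_def algebra_simps)
    ultimately show ?thesis
      by simp
  qed
  \<comment> \<open>The mass \<open>a\<close> at \<open>0\<close> is the least one that lifts the transform of \<open>f\<close> above zero according to
    the bound \<open>C \<Sum> f k cos (k x) \<ge> b\<close>.\<close>
  define b where "b = (\<Sum>\<^sub>\<infinity>k. f k * g k)"
  define a where "a = - b / C"
  have a: "0 \<le> a" "C * a = - b"
    using first_order[OF zero] C by (auto simp: a_def b_def field_simps)
  define F where "F k = f k + (if k = 0 then a else 0)" for k
  have atom: "((\<lambda>k. if k = (0::int) then a else 0) has_sum a) UNIV"
    by (rule has_sum_finite_neutralI[where B = "{0}"]) auto
  have F_summable: "F summable_on UNIV"
    unfolding F_def by (intro summable_on_add f_summable has_sum_imp_summable[OF atom])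
  have F_nonneg: "0 \<le> F k" for k
    using a f_nonneg by (simp add: F_def)
  have F_L1: "F \<in> L1_sym"
    using F_summable F_nonneg by (simp add: L1_sym_def) (simp add: F_def f_sym)
  have F_C: "F \<in> cone_C"
    using F_L1 F_nonneg by (simp add: cone_C_def)
  have F_P: "F \<in> cone_P"
    unfolding cone_P_iff_cosine_series
  proof (intro conjI allI F_L1)
    fix x
    have "b \<le> (\<Sum>\<^sub>\<infinity>k. f k * (C * cos (of_int k * x)))"
      unfolding b_def by (intro first_order scaled_cos_in_pd_ball) (use C in auto)
    also have "\<dots> = C * (\<Sum>\<^sub>\<infinity>k. f k * cos (of_int k * x))"
      by (subst infsum_cmult_right'[symmetric]) (simp add: mult_ac)
    finally have "0 \<le> C * (a + (\<Sum>\<^sub>\<infinity>k. f k * cos (of_int k * x)))"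
      using a by (simp add: algebra_simps)
    then have "0 \<le> a + (\<Sum>\<^sub>\<infinity>k. f k * cos (of_int k * x))"
      using C by (simp add: zero_le_mult_iff)
    also have "\<dots> = (\<Sum>\<^sub>\<infinity>k. F k * cos (of_int k * x))"
    proof -
      have "((\<lambda>k. f k * cos (of_int k * x)) has_sum (\<Sum>\<^sub>\<infinity>k. f k * cos (of_int k * x))) UNIV"
        by (intro has_sum_infsum f_mult[where B = 1]) auto
      from has_sum_add[OF atom this]
      have "((\<lambda>k. (if k = 0 then a else 0) + f k * cos (of_int k * x))
          has_sum (a + (\<Sum>\<^sub>\<infinity>k. f k * cos (of_int k * x)))) UNIV" .
      moreover have "(\<lambda>k. (if k = 0 then a else 0) + f k * cos (of_int k * x))
          = (\<lambda>k. F k * cos (of_int k * x))"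
        by (auto simp: F_def)
      ultimately show ?thesis
        by (simp add: infsumI)
    qed
    finally show "0 \<le> (\<Sum>\<^sub>\<infinity>k. F k * cos (of_int k * x))" .
  qed
  have sum_F: "(\<Sum>k=-R..R. F k) = a + (\<Sum>k=-R..R. f k)" if "0 \<le> R" for R
    using that by (simp add: F_def sum.distrib)
  have "(\<Sum>k=-N..N. f k) = 0"
    by (rule sum.neutral) (simp add: f_inside abs_le_iff)
  then have "(\<Sum>k=-M..M. f k) \<le> - b"
    using adm[of F] F_C F_P sum_F M N a by (simp add: algebra_simps)
  moreover have "(\<Sum>\<^sub>\<infinity>k. f k * ind k) = (\<Sum>k=-M..M. f k)"
    by (intro infsumI has_sum_finite_neutralI[where B = "{-M..M}"]) (auto simp: ind_def)
  moreover have "Q g = (\<Sum>\<^sub>\<infinity>k. f k * g k) + (\<Sum>\<^sub>\<infinity>k. f k * ind k)"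
  proof -
    have "w k * (p g k)\<^sup>2 = f k * g k + f k * ind k" for k
      by (auto simp: f_def p_def max_def power2_eq_square algebra_simps)
    then show ?thesis
      unfolding Q_def using f_mult[OF pd_ball_bound[OF g]] f_mult[of ind 1] ind
      by (simp add: infsum_add)
  qed
  ultimately have "Q g \<le> 0"
    by (simp add: b_def)
  have "g k \<le> - indicator {-M..M} k" if k: "\<bar>k\<bar> > N" for k
  proof -
    have "w k * (p g k)\<^sup>2 = 0"
      using \<open>Q g \<le> 0\<close> unfolding Q_def
      by (rule nonneg_infsum_le_0D) (auto intro: w_mult[OF p2_bound[OF g]] simp: w_nonneg)
    with k show ?thesis
      by (auto simp: w_def p_def ind_def max_def split: if_splits)
  qed
  with g show ?thesis
    by blast
qed

section \<open>Comparison of the two infima\<close>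

definition admissible_C :: "nat \<Rightarrow> nat \<Rightarrow> real set" where
  "admissible_C L N = {C. \<forall>f \<in> cone_C \<inter> cone_P.
     (\<Sum>k = - int (L * N)..int (L * N). f k) \<le> (C + 1) * (\<Sum>k = - int N..int N. f k)}"

definition admissible_K :: "nat \<Rightarrow> nat \<Rightarrow> real set" where
  "admissible_K L N = {h 0 | h. h \<in> Linf_sym \<and> positive_definite h \<and>
     (\<forall>k. \<bar>k\<bar> > int N \<longrightarrow> h k \<le> - indicator {- int (L * N)..int (L * N)} k)}"

lemma admissible_C_mono:
  assumes "C \<in> admissible_C L N" "C \<le> C'"
  shows "C' \<in> admissible_C L N"
  unfolding admissible_C_def
proof (intro CollectI ballI)
  fix f assume f: "f \<in> cone_C \<inter> cone_P"
  then have "(C + 1) * (\<Sum>k = - int N..int N. f k) \<le> (C' + 1) * (\<Sum>k = - int N..int N. f k)"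
    using assms by (intro mult_right_mono sum_nonneg) (auto simp: cone_C_def)
  moreover have "(\<Sum>k = - int (L * N)..int (L * N). f k) \<le> (C + 1) * (\<Sum>k = - int N..int N. f k)"
    using f assms(1) unfolding admissible_C_def by blast
  ultimately show "(\<Sum>k = - int (L * N)..int (L * N). f k) \<le> (C' + 1) * (\<Sum>k = - int N..int N. f k)"
    by linarith
qed

text \<open>
  The unit mass at \<open>0\<close> lies in both cones.
\<close>

lemma admissible_C_nonneg:
  assumes "C \<in> admissible_C L N"
  shows "0 \<le> C"
proof -
  let ?\<delta> = "\<lambda>k::int. if k = 0 then 1 else 0 :: real"
  have "?\<delta> \<in> L1_sym"
    unfolding L1_sym_def using has_sum_finite_neutralI[of "{0::int}" UNIV "\<lambda>k. \<bar>?\<delta> k\<bar>"]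
    by (auto simp: summable_on_def)
  moreover have "(\<Sum>\<^sub>\<infinity>k. ?\<delta> k * cos (of_int k * x)) = 1" for x
    by (intro infsumI has_sum_finite_neutralI[of "{0::int}"]) auto
  ultimately have "?\<delta> \<in> cone_C \<inter> cone_P"
    by (auto simp: cone_C_def cone_P_iff_cosine_series)
  from bspec[OF assms[unfolded admissible_C_def mem_Collect_eq] this] show ?thesis
    by simp
qed

lemma admissible_C_nonempty: "2 * real (L * N) \<in> admissible_C L N"
  unfolding admissible_C_def
proof (intro CollectI ballI)
  fix f assume f: "f \<in> cone_C \<inter> cone_P"
  have "(\<Sum>k = - int (L * N)..int (L * N). f k) \<le> (\<Sum>k = - int (L * N)..int (L * N). f 0)"
    using f by (intro sum_mono cone_P_le_at_0) auto
  also have "\<dots> = (2 * real (L * N) + 1) * f 0"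
    by simp
  also have "\<dots> \<le> (2 * real (L * N) + 1) * (\<Sum>k = - int N..int N. f k)"
    using f by (intro mult_left_mono member_le_sum) (auto simp: cone_C_def)
  finally show "(\<Sum>k = - int (L * N)..int (L * N). f k)
      \<le> (2 * real (L * N) + 1) * (\<Sum>k = - int N..int N. f k)" .
qed

lemma admissible_K_subset_admissible_C:
  assumes "L \<ge> 1"
  shows "admissible_K L N \<subseteq> admissible_C L N"
proof -
  have "N \<le> L * N"
    using assms by simp
  then show ?thesis
    unfolding admissible_K_def admissible_C_def Linf_sym_def
    by (auto intro!: dual_certificate_bound simp del: of_nat_mult)
qed

text \<open>
  Strict positivity of \<open>C\<close> is what strong duality needs (it divides by \<open>C\<close>); together with
  upward closedness of the admissible \<open>C\<close> this suffices for comparing infima.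
\<close>

lemma admissible_K_below:
  assumes "C \<in> admissible_C L N" "C > 0"
  shows "\<exists>c\<in>admissible_K L N. c \<le> C"
proof -
  obtain h where h: "h \<in> pd_ball C"
      "\<forall>k. \<bar>k\<bar> > int N \<longrightarrow> h k \<le> - indicator {- int (L * N)..int (L * N)} k"
    using dual_certificate_exists[of C "int (L * N)" "int N"] assms
    by (auto simp: admissible_C_def simp del: of_nat_mult)
  have "bounded (range h)"
    using pd_ball_bound[OF h(1)] by (auto simp: bounded_iff)
  with h have "h 0 \<in> admissible_K L N" "h 0 \<le> C"
    by (auto simp: admissible_K_def Linf_sym_def pd_ball_def simp del: of_nat_mult)
  then show ?thesis
    by blast
qed

theorem theorem5:
  fixes L N :: nat
  assumes "L \<ge> 1" and "N \<ge> 1"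
  shows "C_const L N = K_const L N"
proof -
  have C_def: "C_const L N = Inf (admissible_C L N)"
    by (simp add: C_const_def admissible_C_def)
  have K_def: "K_const L N = Inf (admissible_K L N)"
    by (simp add: K_const_def admissible_K_def)
  have sub: "admissible_K L N \<subseteq> admissible_C L N"
    using assms(1) by (rule admissible_K_subset_admissible_C)
  have bdd: "bdd_below (admissible_C L N)"
    using admissible_C_nonneg by (rule bdd_belowI)
  have bddK: "bdd_below (admissible_K L N)"
    using bdd sub by (rule bdd_below_mono)
  have le: "Inf (admissible_K L N) \<le> C" if "C \<in> admissible_C L N" "C > 0" for C
    using admissible_K_below[OF that] cInf_lower2 bddK by blast
  have "1 + 2 * real (L * N) \<in> admissible_C L N"
    by (rule admissible_C_mono[OF admissible_C_nonempty]) simp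
  moreover have "0 < 1 + 2 * real (L * N)"
    by (rule add_pos_nonneg) auto
  ultimately have "admissible_K L N \<noteq> {}"
    using admissible_K_below by blast
  then have "Inf (admissible_C L N) \<le> Inf (admissible_K L N)"
    using bdd sub by (rule cInf_superset_mono)
  moreover have "Inf (admissible_K L N) \<le> Inf (admissible_C L N)"
  proof (rule cInf_greatest)
    show "admissible_C L N \<noteq> {}"
      using admissible_C_nonempty by blast
    fix C assume C: "C \<in> admissible_C L N"
    show "Inf (admissible_K L N) \<le> C"
    proof (rule field_le_epsilon)
      fix e :: real assume "0 < e"
      then show "Inf (admissible_K L N) \<le> C + e"
        using C admissible_C_nonneg[OF C] by (intro le admissible_C_mono[OF C]) auto
    qed
  qed
  ultimately show ?thesis
    unfolding C_def K_def by (rule antisym)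
qed

end
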